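(* For each $k\ge 1$ let $\omega^k$ be a shortest $k$-complete word (of length $\lambda(k)$), and define words $W^n$ inductively by $W^1:=1$ and, for $n\ge 1$, $W^{n+1}:=W^n,\,n+1,\,\omega^n$ (concatenation of $W^n$, the letter $n+1$, and $\omega^n$). Then for every $n\ge 1$ the word $W^n$ fixes every $n$-component monotone network. Therefore \[ \lambda_M(n)\ \le\ n+\sum_{i=1}^{n-1}\lambda(i)\ \le\ \frac{n^3}{3}-\frac{3n^2}{2}+\frac{37n}{6}. \]
   Context: An $n$-component (Boolean) network is a function $f=(f_1,\dots,f_n):\{0,1\}^n\to\{0,1\}^n$. Write $[n]=\{1,\dots,n\}$. For $i\in[n]$ and $x\in\{0,1\}^n$, $f^i(x):=(x_1,\dots,x_{i-1},f_i(x),x_{i+1},\dots,x_n)$. For a word $w=i_1i_2\dots i_k$ over the alphabet $[n]$, $f^w:=f^{i_k}\circ\cdots\circ f^{i_1}$ (and $f^\epsilon=\mathrm{id}$ for the empty word). A word $w$ fixes $f$ if $f^w(x)$ is a fixed point of $f$ for every $x\in\{0,1\}^n$. The network $f$ is monotone if $x\le y$ (componentwise) implies $f(x)\le f(y)$ for all $x,y$. $\lambda_M(n)$ denotes the minimum length of a single word over $[n]$ that fixes all $n$-component monotone networks. A word is $n$-complete if it contains every permutation of $[n]$ (viewed as a word $i_1\dots i_n$ using each letter once) as a (not necessarily contiguous) subsequence; $\lambda(n)$ is the length of a shortest $n$-complete word. It is a known result that $\lambda(n)\le n^2-2n+4$ for all $n\ge 1$. *)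

theory Defs
  imports Complex_Main "HOL-Library.FuncSet" "HOL-Library.Sublist"
    "HOL-Combinatorics.Multiset_Permutations"
begin

text \<open>
  The cube of dimension \<open>n\<close> is the set of extensional functions from \<open>{1..n}\<close> to Booleans
  (\<open>False\<close> is 0, \<open>True\<close> is 1). Two of its elements agree outside \<open>{1..n}\<close>, so
  the pointwise order of \<^typ>\<open>nat \<Rightarrow> bool\<close> is on it the componentwise order.
\<close>

definition states :: "nat \<Rightarrow> (nat \<Rightarrow> bool) set" where
  "states n = ({1..n} \<rightarrow>\<^sub>E (UNIV :: bool set))"

type_synonym network = "(nat \<Rightarrow> bool) \<Rightarrow> (nat \<Rightarrow> bool)"

text \<open>The \<open>i\<close>-th component of \<open>f\<close> is \<open>\<lambda>x. f x i\<close>; values of \<open>f\<close> outside the cube are irrelevant.\<close>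

definition networks :: "nat \<Rightarrow> network set" where
  "networks n = (states n \<rightarrow> states n)"

definition monotone_networks :: "nat \<Rightarrow> network set" where
  "monotone_networks n = {f \<in> networks n. mono_on (states n) f}"

definition update :: "network \<Rightarrow> nat \<Rightarrow> (nat \<Rightarrow> bool) \<Rightarrow> (nat \<Rightarrow> bool)" where
  "update f i x = x(i := f x i)"

text \<open>The leftmost letter of the word acts first.\<close>

definition run :: "network \<Rightarrow> nat list \<Rightarrow> (nat \<Rightarrow> bool) \<Rightarrow> (nat \<Rightarrow> bool)" where
  "run f w = fold (update f) w"

definition word_fixes :: "nat \<Rightarrow> nat list \<Rightarrow> network \<Rightarrow> bool" where
  "word_fixes n w f \<longleftrightarrow> (\<forall>x \<in> states n. f (run f w x) = run f w x)"

definition fixes_all_monotone :: "nat \<Rightarrow> nat list \<Rightarrow> bool" where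
  "fixes_all_monotone n w \<longleftrightarrow>
     w \<in> lists {1..n} \<and> (\<forall>f \<in> monotone_networks n. word_fixes n w f)"

definition lambda_M :: "nat \<Rightarrow> nat" where
  "lambda_M n = (LEAST l. \<exists>w. fixes_all_monotone n w \<and> length w = l)"

definition complete_word :: "nat \<Rightarrow> nat list \<Rightarrow> bool" where
  "complete_word n w \<longleftrightarrow>
     w \<in> lists {1..n} \<and> (\<forall>p \<in> permutations_of_set {1..n}. subseq p w)"

definition lambda_complete :: "nat \<Rightarrow> nat" where
  "lambda_complete n = (LEAST l. \<exists>w. complete_word n w \<and> length w = l)"

definition shortest_complete_word :: "nat \<Rightarrow> nat list \<Rightarrow> bool" where
  "shortest_complete_word n w \<longleftrightarrow> complete_word n w \<and> length w = lambda_complete n"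

text \<open>The sequence starts at index 1; the value at 0 is a dummy that no other value depends on.\<close>

fun W :: "(nat \<Rightarrow> nat list) \<Rightarrow> nat \<Rightarrow> nat list" where
  "W \<omega> 0 = []"
| "W \<omega> (Suc 0) = [1]"
| "W \<omega> (Suc (Suc m)) = W \<omega> (Suc m) @ [Suc (Suc m)] @ \<omega> (Suc m)"

end

theory Submission
  imports Defs
begin

text \<open>
  Suppose \<open>W\<^sup>n\<close> has fixed the first \<open>n\<close> components, and that the letter \<open>n + 1\<close> then gives
  component \<open>n + 1\<close> the value \<open>v\<close>. By monotonicity no component is now pulled away from \<open>v\<close>,
  and from such a state every update moves towards \<open>v\<close>. Hence some updates with
  distinct letters lead to a fixed point; they extend to a permutation, which is a subsequence of
  \<open>\<omega>\<^sup>n\<close>, and additional updates cannot move beyond a fixed point.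

  For the bound on \<open>\<lambda>(m + 1)\<close>, cut the cyclic word \<open>1 2 \<dots> m 1 2 \<dots>\<close> into one block of
  length \<open>m\<close>, then \<open>m - 1\<close> blocks of length \<open>m - 1\<close>, then one of length \<open>1\<close>, and put the letter
  \<open>m + 1\<close> in front of every block. In the cyclic word the first letter of a repetition-free
  word is found within \<open>m\<close> steps and each further one within \<open>m - 1\<close> steps, so the part of a
  permutation before the letter \<open>m + 1\<close> ends in time for the corresponding block boundary.
\<close>

section \<open>Updates towards a fixed value\<close>

text \<open>One order for each \<open>v\<close>: the componentwise order for \<open>True\<close> and its dual for \<open>False\<close>.\<close>

definition below :: "bool \<Rightarrow> (nat \<Rightarrow> bool) \<Rightarrow> (nat \<Rightarrow> bool) \<Rightarrow> bool" where
  "below v x y \<longleftrightarrow> (\<forall>i. x i = v \<longrightarrow> y i = v)"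

lemma below_refl: "below v x x"
  by (simp add: below_def)

lemma below_trans: "below v x y \<Longrightarrow> below v y z \<Longrightarrow> below v x z"
  by (simp add: below_def)

lemma below_antisym: "below v x y \<Longrightarrow> below v y x \<Longrightarrow> x = y"
  unfolding below_def by (rule ext) metis

lemma run_Nil [simp]: "run f [] x = x"
  and run_Cons [simp]: "run f (i # w) x = run f w (update f i x)"
  and run_append [simp]: "run f (u @ w) x = run f w (run f u x)"
  by (simp_all add: run_def)

lemma run_outside: "i \<notin> set w \<Longrightarrow> run f w x i = x i"
  by (induction w arbitrary: x) (auto simp: update_def)

lemma run_fixed: "(\<And>i. i \<in> set w \<Longrightarrow> f x i = x i) \<Longrightarrow> run f w x = x"
  by (induction w) (auto simp: update_def)

locale monotone_updates =
  fixes f :: network and S :: "(nat \<Rightarrow> bool) set" and A :: "nat set" and v :: bool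
  assumes mono: "x \<in> S \<Longrightarrow> y \<in> S \<Longrightarrow> below v x y \<Longrightarrow> below v (f x) (f y)"
    and update_closed: "x \<in> S \<Longrightarrow> i \<in> A \<Longrightarrow> update f i x \<in> S"
begin

text \<open>On \<open>A\<close> this says that \<open>x\<close> lies below \<open>f x\<close>, the
  condition from which asynchronous iteration can only climb.\<close>

definition stable :: "(nat \<Rightarrow> bool) \<Rightarrow> bool" where
  "stable x \<longleftrightarrow> (\<forall>i\<in>A. x i = v \<longrightarrow> f x i = v)"

lemma run_closed: "x \<in> S \<Longrightarrow> set w \<subseteq> A \<Longrightarrow> run f w x \<in> S"
  by (induction w arbitrary: x) (auto simp: update_closed)

lemma update_mono:
  assumes "x \<in> S" "y \<in> S" "below v x y"
  shows "below v (update f i x) (update f i y)"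
  using mono[OF assms] assms(3) by (auto simp: below_def update_def)

lemma run_mono:
  "x \<in> S \<Longrightarrow> y \<in> S \<Longrightarrow> set w \<subseteq> A \<Longrightarrow> below v x y \<Longrightarrow> below v (run f w x) (run f w y)"
  by (induction w arbitrary: x y) (auto simp: update_closed update_mono)

lemma below_update: "stable x \<Longrightarrow> i \<in> A \<Longrightarrow> below v x (update f i x)"
  by (auto simp: below_def update_def stable_def)

lemma stable_update:
  assumes "stable x" "i \<in> A" "x \<in> S"
  shows "stable (update f i x)"
proof -
  have "below v (f x) (f (update f i x))"
    by (intro mono below_update update_closed assms)
  then show ?thesis
    using assms by (auto simp: stable_def below_def update_def)
qed

lemma below_run: "stable x \<Longrightarrow> x \<in> S \<Longrightarrow> set w \<subseteq> A \<Longrightarrow> below v x (run f w x)"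
proof (induction w arbitrary: x)
  case (Cons i w)
  then have "below v (update f i x) (run f w (update f i x))"
    by (intro Cons.IH) (auto simp: stable_update update_closed)
  moreover have "below v x (update f i x)"
    using Cons.prems by (intro below_update) auto
  ultimately show ?case
    by (auto intro: below_trans)
qed (simp add: below_refl)

text \<open>Shared letters preserve the order by monotonicity; a letter of \<open>w\<close> alone
  only moves the stable \<open>y\<close> further towards \<open>v\<close>.\<close>

lemma run_subseq_below:
  assumes "subseq u w" "set w \<subseteq> A" "x \<in> S" "y \<in> S" "below v x y" "stable y"
  shows "below v (run f u x) (run f w y)"
  using assms
proof (induction arbitrary: x y rule: list_emb.induct)
  case (list_emb_Nil w)
  then show ?case
    using below_run below_trans by fastforce
next
  case (list_emb_Cons u w i)
  then have "below v x (update f i y)"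
    by (auto intro: below_trans below_update)
  with list_emb_Cons show ?case
    by (auto simp: stable_update update_closed)
next
  case (list_emb_Cons2 i j u w)
  then show ?case
    by (auto simp: stable_update update_closed update_mono)
qed

text \<open>From a stable point an unfixed component in \<open>A\<close> can only flip to
  \<open>v\<close>, where it stays; so no letter is used twice and the measure drops.\<close>

lemma ex_distinct_run_fixed:
  assumes "finite A" "x \<in> S" "stable x"
  shows "\<exists>l. distinct l \<and> set l \<subseteq> {i\<in>A. x i \<noteq> v} \<and> (\<forall>i\<in>A. f (run f l x) i = run f l x i)"
  using assms(2,3)
proof (induction "card {i\<in>A. x i \<noteq> v}" arbitrary: x rule: less_induct)
  case less
  show ?case
  proof (cases "\<forall>i\<in>A. f x i = x i")
    case True
    then show ?thesis by (intro exI[of _ "[]"]) simp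
  next
    case False
    then obtain i where i: "i \<in> A" "f x i \<noteq> x i" by blast
    then have iv: "x i \<noteq> v" "f x i = v"
      using less.prems by (auto simp: stable_def)
    let ?y = "update f i x"
    have eq: "{j\<in>A. ?y j \<noteq> v} = {j\<in>A. x j \<noteq> v} - {i}"
      using iv by (auto simp: update_def)
    have "card {j\<in>A. ?y j \<noteq> v} < card {j\<in>A. x j \<noteq> v}"
      unfolding eq using i iv assms(1) by (intro card_Diff1_less) auto
    from less.hyps[OF this] obtain l where
      "distinct l" "set l \<subseteq> {j\<in>A. ?y j \<noteq> v}" "\<forall>j\<in>A. f (run f l ?y) j = run f l ?y j"
      using less.prems i by (auto simp: stable_update update_closed)
    with i iv show ?thesis
      unfolding eq by (intro exI[of _ "i # l"]) auto
  qed
qed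

lemma complete_run_fixed:
  assumes "finite A" "x \<in> S" "stable x" "set w \<subseteq> A"
    and complete: "\<And>p. p \<in> permutations_of_set A \<Longrightarrow> subseq p w"
    and "i \<in> A"
  shows "f (run f w x) i = run f w x i"
proof -
  obtain l where l: "distinct l" "set l \<subseteq> A"
    and fixed: "\<forall>i\<in>A. f (run f l x) i = run f l x i"
    using ex_distinct_run_fixed[OF assms(1-3)] by blast
  let ?z = "run f l x"
  \<comment> \<open>\<open>r\<close> completes \<open>l\<close> to a permutation; its letters change
    nothing at \<open>?z\<close>, which is fixed on \<open>A\<close>.\<close>
  obtain r where r: "set r = A - set l" "distinct r"
    using finite_distinct_list[of "A - set l"] assms(1) by auto
  have "run f (l @ r) x = ?z"
    using fixed r by (auto intro: run_fixed)
  moreover have "subseq (l @ r) w"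
    using l r by (intro complete) (auto simp: permutations_of_set_def)
  ultimately have "below v ?z (run f w x)"
    using run_subseq_below[of "l @ r" w x x] assms by (simp add: below_refl)
  \<comment> \<open>The reverse bound: \<open>x\<close> lies below \<open>?z\<close>, and
    \<open>w\<close> leaves \<open>?z\<close> unchanged.\<close>
  moreover have "below v (run f w x) (run f w ?z)"
    using assms l by (intro run_mono below_run run_closed)
  moreover have "run f w ?z = ?z"
    using fixed assms(4) by (auto intro: run_fixed)
  ultimately have "run f w x = ?z"
    by (auto intro: below_antisym)
  with fixed assms(6) show ?thesis by simp
qed

end

section \<open>The words \<open>W\<^sup>n\<close>\<close>

lemma update_in_states:
  assumes "f \<in> networks n" "x \<in> states n" "i \<in> {1..n}"
  shows "update f i x \<in> states n"
  using assms by (auto simp: update_def states_def PiE_def extensional_def)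

lemma monotone_updates_networks:
  assumes "f \<in> monotone_networks n" "m \<le> n"
  shows "monotone_updates f (states n) {1..m} v"
proof
  fix x y assume xy: "x \<in> states n" "y \<in> states n" "below v x y"
  have mono: "mono_on (states n) f"
    using assms by (simp add: monotone_networks_def)
  show "below v (f x) (f y)"
  proof (cases v)
    case True
    then have "x \<le> y" using xy by (auto simp: below_def le_fun_def)
    then have "f x \<le> f y" by (rule mono_onD[OF mono xy(1,2)])
    then show ?thesis using True by (auto simp: below_def le_fun_def)
  next
    case False
    then have "y \<le> x" using xy by (auto simp: below_def le_fun_def)
    then have "f y \<le> f x" by (rule mono_onD[OF mono xy(2,1)])
    then show ?thesis using False by (auto simp: below_def le_fun_def)
  qed
next
  fix x i assume "x \<in> states n" "i \<in> {1..m}"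
  then show "update f i x \<in> states n"
    using assms by (intro update_in_states) (auto simp: monotone_networks_def)
qed

lemma set_W:
  assumes "\<forall>k\<ge>1. complete_word k (\<omega> k)"
  shows "set (W \<omega> n) \<subseteq> {1..n}"
proof (induction n rule: induct_nat_012)
  case (ge2 n)
  have "set (\<omega> (Suc n)) \<subseteq> {1..Suc n}"
    using assms by (auto simp: complete_word_def)
  with ge2 show ?case by fastforce
qed auto

text \<open>
  Keeping the number \<open>n\<close> of components fixed while \<open>m\<close> grows makes it unnecessary to restrict
  the network to a subcube.
\<close>

lemma run_W_fixed:
  assumes \<omega>: "\<forall>k\<ge>1. complete_word k (\<omega> k)"
    and f: "f \<in> monotone_networks n"
    and x: "x \<in> states n"
  shows "1 \<le> m \<Longrightarrow> m \<le> n \<Longrightarrow> i \<in> {1..m} \<Longrightarrow> f (run f (W \<omega> m) x) i = run f (W \<omega> m) x i"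
proof (induction m arbitrary: i rule: nat_induct_at_least)
  case base
  \<comment> \<open>Taking for \<open>v\<close> the value about to be written makes \<open>x\<close>
    stable on the single component 1.\<close>
  interpret monotone_updates f "states n" "{1..1}" "f x 1"
    using f base by (intro monotone_updates_networks)
  have "stable x" unfolding stable_def by auto
  then have "below (f x 1) (f x) (f (update f 1 x))"
    using x by (intro mono below_update update_closed) auto
  then have "f (update f 1 x) 1 = f x 1"
    by (simp only: below_def)
  moreover have "update f 1 x 1 = f x 1"
    by (simp add: update_def)
  ultimately show ?case
    using base by simp
next
  case (Suc m)
  define y where "y = run f (W \<omega> m) x"
  define v where "v = f y (Suc m)"
  define z where "z = update f (Suc m) y"
  have W: "run f (W \<omega> (Suc m)) x = run f (\<omega> m) z"
    using Suc.hyps by (cases m) (simp_all add: y_def z_def)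
  have y_fixed: "f y j = y j" if "j \<in> {1..m}" for j
    using Suc that by (simp add: y_def)
  have \<omega>_set: "set (\<omega> m) \<subseteq> {1..m}"
    and \<omega>_perm: "\<And>p. p \<in> permutations_of_set {1..m} \<Longrightarrow> subseq p (\<omega> m)"
    using \<omega> Suc.hyps by (auto simp: complete_word_def)
  interpret monotone_updates f "states n" "{1..m}" v
    using f Suc.prems by (intro monotone_updates_networks) auto
  have y: "y \<in> states n"
    unfolding y_def using x set_W[OF \<omega>] by (intro run_closed)
  then have z: "z \<in> states n"
    using f Suc.prems by (auto simp: z_def monotone_networks_def intro!: update_in_states)
  have z_top: "z (Suc m) = v"
    by (simp add: z_def v_def update_def)
  \<comment> \<open>Only component \<open>Suc m\<close> may differ, and in \<open>z\<close> it is
    \<open>v\<close>.\<close>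
  have "below v y z"
    by (auto simp: below_def z_def v_def update_def)
  then have f_yz: "below v (f y) (f z)"
    using y z by (intro mono)
  have "stable z"
    unfolding stable_def
  proof (intro ballI impI)
    fix j assume j: "j \<in> {1..m}" "z j = v"
    then have "f y j = v"
      using y_fixed by (simp add: z_def update_def)
    with f_yz show "f z j = v" by (simp add: below_def)
  qed
  show ?case
  proof (cases "i = Suc m")
    case True
    \<comment> \<open>The run from \<open>z\<close> goes towards \<open>v\<close>, so
      \<open>f\<close> still gives \<open>v\<close> here; \<open>\<omega> m\<close> lacks the letter
      \<open>Suc m\<close>.\<close>
    have "below v (f z) (f (run f (\<omega> m) z))"
      using \<open>stable z\<close> z \<omega>_set by (intro mono below_run run_closed)
    with f_yz have "f (run f (\<omega> m) z) (Suc m) = v"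
      by (simp add: below_def v_def)
    moreover have "run f (\<omega> m) z (Suc m) = v"
      using \<omega>_set z_top by (subst run_outside) auto
    ultimately show ?thesis
      unfolding W True by simp
  next
    case False
    then show ?thesis
      unfolding W using Suc.prems z \<open>stable z\<close> \<omega>_set \<omega>_perm
      by (intro complete_run_fixed) auto
  qed
qed

lemma W_fixes_all_monotone:
  assumes \<omega>: "\<forall>k\<ge>1. complete_word k (\<omega> k)" and "n \<ge> 1"
  shows "fixes_all_monotone n (W \<omega> n)"
  unfolding fixes_all_monotone_def word_fixes_def
proof (intro conjI ballI)
  show "W \<omega> n \<in> lists {1..n}"
    using set_W[OF \<omega>] by auto
next
  fix f x assume f: "f \<in> monotone_networks n" and x: "x \<in> states n"
  interpret monotone_updates f "states n" "{1..n}" True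
    using f by (intro monotone_updates_networks) auto
  have y: "run f (W \<omega> n) x \<in> states n"
    using x set_W[OF \<omega>] by (intro run_closed)
  then have "f (run f (W \<omega> n) x) \<in> states n"
    using f by (auto simp: monotone_networks_def networks_def)
  with y show "f (run f (W \<omega> n) x) = run f (W \<omega> n) x"
    using run_W_fixed[OF \<omega> f x \<open>n \<ge> 1\<close> order_refl]
    unfolding states_def by (intro PiE_ext)
qed

lemma length_W:
  "n \<ge> 1 \<Longrightarrow> length (W \<omega> n) = n + (\<Sum>i = 1..n - 1. length (\<omega> i))"
proof (induction n rule: nat_induct_at_least)
  case (Suc n)
  then show ?case by (cases n) simp_all
qed simp

section \<open>A complete word of length \<open>n\<^sup>2 - 2n + 4\<close>\<close>

definition cyc :: "nat \<Rightarrow> nat \<Rightarrow> nat" where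
  "cyc m t = Suc (t mod m)"

lemma cyc_next:
  assumes "m \<ge> 1" "a \<in> {1..m}"
  obtains t where "s \<le> t" "t < s + m" "cyc m t = a"
proof
  \<comment> \<open>The offset is \<open>a - 1 - s\<close> modulo \<open>m\<close>, written with
    \<open>m - s mod m\<close> to avoid truncated subtraction.\<close>
  let ?t = "s + (a - 1 + (m - s mod m)) mod m"
  show "s \<le> ?t" by simp
  show "?t < s + m" using assms by simp
  have "s mod m \<le> m" using assms by (simp add: less_imp_le)
  have "?t mod m = (s mod m + (a - 1 + (m - s mod m))) mod m"
    by (simp add: mod_simps)
  also have "s mod m + (a - 1 + (m - s mod m)) = a - 1 + m"
    using \<open>s mod m \<le> m\<close> by simp
  also have "\<dots> mod m = a - 1"
    using assms by (simp only: mod_add_self2) auto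
  finally show "cyc m ?t = a"
    using assms by (simp add: cyc_def)
qed

lemma upt_split: "i \<le> j \<Longrightarrow> j \<le> k \<Longrightarrow> [i..<k] = [i..<j] @ [j..<k]"
  using upt_add_eq_append[of i j "k - j"] by simp

lemma subseq_map_upt:
  assumes "s \<le> s'" "t' \<le> t"
  shows "subseq (map g [s'..<t']) (map g [s..<t])"
proof (cases "s' \<le> t'")
  case True
  then have "[s..<t] = [s..<s'] @ [s'..<t'] @ [t'..<t]"
    using assms True upt_split[of s s' t] upt_split[of s' t' t] by simp
  then show ?thesis
    by (simp add: list_emb_append2 list_emb_prefix)
qed simp

text \<open>The letter at position \<open>s\<close> recurs at \<open>s + m\<close> and is not in
  \<open>l\<close>, so the next letter of \<open>l\<close> occurs within \<open>m - 1\<close> steps.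
  Distinctness recreates this situation there.\<close>

lemma subseq_cyc_after:
  assumes "m \<ge> 1" "distinct l" "set l \<subseteq> {1..m}" "cyc m s \<notin> set l"
    "s + length l * (m - 1) < t"
  shows "subseq l (map (cyc m) [Suc s..<t])"
  using assms(2-)
proof (induction l arbitrary: s)
  case (Cons a l)
  obtain u where u: "Suc s \<le> u" "u < Suc s + m" "cyc m u = a"
    using cyc_next[OF assms(1)] Cons.prems by (metis list.set_intros(1) subsetD)
  have "u \<noteq> s + m"
    using u Cons.prems by (auto simp: cyc_def)
  then have le: "u + length l * (m - 1) < t"
    using u Cons.prems by simp
  then have "subseq l (map (cyc m) [Suc u..<t])"
    using u Cons.prems by (intro Cons.IH) auto
  then have "subseq (a # l) (map (cyc m) [u..<t])"
    using u le by (simp add: upt_conv_Cons)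
  also have "subseq \<dots> (map (cyc m) [Suc s..<t])"
    using u by (intro subseq_map_upt) auto
  finally show ?case .
qed simp

text \<open>This includes \<open>l = []\<close>, where the truncated \<open>length l - 1\<close> is harmless.\<close>

lemma subseq_cyc:
  assumes "m \<ge> 1" "distinct l" "set l \<subseteq> {1..m}"
    "s + m + (length l - 1) * (m - 1) \<le> t"
  shows "subseq l (map (cyc m) [s..<t])"
proof (cases l)
  case (Cons a l')
  obtain u where u: "s \<le> u" "u < s + m" "cyc m u = a"
    using cyc_next[OF assms(1)] assms(3) Cons by (metis list.set_intros(1) subsetD)
  have le: "u + length l' * (m - 1) < t"
    using u assms Cons by simp
  have "subseq l' (map (cyc m) [Suc u..<t])"
    using assms Cons u le by (intro subseq_cyc_after) auto
  then have "subseq (a # l') (map (cyc m) [u..<t])"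
    using u le by (simp add: upt_conv_Cons)
  also have "subseq \<dots> (map (cyc m) [s..<t])"
    using u by (intro subseq_map_upt) auto
  finally show ?thesis using Cons by simp
qed simp

section \<open>Cutting the cyclic word into blocks\<close>

lemma subseq_concat_blocks:
  assumes "mono p" "j \<le> k"
  shows "subseq (map g [p j..<p k]) (concat (map (\<lambda>i. x # map g [p i..<p (Suc i)]) [j..<k]))"
  using assms(2)
proof (induction k rule: dec_induct)
  case (step k)
  have "p j \<le> p k" "p k \<le> p (Suc k)"
    using assms(1) step by (auto intro: monoD)
  then have "[p j..<p (Suc k)] = [p j..<p k] @ [p k..<p (Suc k)]"
    by (rule upt_split)
  with step show ?case
    by (auto intro!: list_emb_append_mono)
qed simp

lemma length_concat_blocks:
  assumes "mono p"
  shows "length (concat (map (\<lambda>i. x # map g [p i..<p (Suc i)]) [0..<k])) = k + (p k - p 0)"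
proof (induction k)
  case (Suc k)
  have "p 0 \<le> p k" "p k \<le> p (Suc k)"
    using assms by (auto intro: monoD)
  with Suc show ?case by simp
qed simp

text \<open>The end of the \<open>k\<close>-th block in the cyclic word, for \<open>k \<le> m + 1\<close>.\<close>

definition block_end :: "nat \<Rightarrow> nat \<Rightarrow> nat" where
  "block_end m k = (if k = 0 then 0 else if k \<le> m then m + (k - 1) * (m - 1) else m + (m - 1) * (m - 1) + 1)"

lemma mono_block_end: "mono (block_end m)"
proof
  fix j k :: nat assume "j \<le> k"
  then have "(j - 1) * (m - 1) \<le> (k - 1) * (m - 1)"
    by (intro mult_right_mono) auto
  moreover have "(j - 1) * (m - 1) \<le> (m - 1) * (m - 1)" if "j \<le> m"
    using that by (intro mult_right_mono) auto
  ultimately show "block_end m j \<le> block_end m k"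
    using \<open>j \<le> k\<close> by (auto simp: block_end_def intro: le_SucI)
qed

definition short_complete :: "nat \<Rightarrow> nat list" where
  "short_complete m =
     concat (map (\<lambda>k. Suc m # map (cyc m) [block_end m k..<block_end m (Suc k)]) [0..<Suc m])"

lemma complete_short_complete:
  assumes m: "m \<ge> 1"
  shows "complete_word (Suc m) (short_complete m)"
  unfolding complete_word_def
proof (intro conjI ballI)
  have "cyc m t \<in> {1..Suc m}" for t
    using m by (auto simp: cyc_def less_imp_le)
  then show "short_complete m \<in> lists {1..Suc m}"
    unfolding short_complete_def in_lists_conv_set by auto
next
  fix p assume p: "p \<in> permutations_of_set {1..Suc m}"
  then have set_p: "set p = {1..Suc m}" and dist_p: "distinct p"
    by (auto simp: permutations_of_set_def)
  then obtain a b where ab: "p = a @ Suc m # b"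
    using split_list[of "Suc m" p] by auto
  then have dist: "distinct a" "distinct b" "Suc m \<notin> set a" "Suc m \<notin> set b"
    using dist_p by auto
  have sub: "set a \<subseteq> {1..m}" "set b \<subseteq> {1..m}"
    using set_p dist ab by (auto simp: le_Suc_eq)
  have "length p = Suc m"
    using distinct_card[OF dist_p] set_p by simp
  then have len: "length a + length b = m"
    using ab by simp
  define k where "k = length a"
  have k: "k \<le> m" using len by (simp add: k_def)
  let ?blk = "\<lambda>k. Suc m # map (cyc m) [block_end m k..<block_end m (Suc k)]"
  \<comment> \<open>For \<open>k > 0\<close>, \<open>block_end m k\<close> is exactly the bound of
    \<open>subseq_cyc\<close> for \<open>k\<close> letters read from position 0.\<close>
  have a: "subseq a (map (cyc m) [block_end m 0..<block_end m k])"
  proof (cases "k = 0")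
    case False
    then show ?thesis
      using dist sub m k by (intro subseq_cyc) (auto simp: block_end_def k_def)
  qed (simp add: k_def)
  have b: "subseq b (map (cyc m) [block_end m k..<block_end m (Suc m)])"
  proof (cases "b = []")
    case False
    obtain c where c: "length b = Suc c"
      using False by (cases b) auto
    \<comment> \<open>For \<open>k > 0\<close> equality holds, which accounts for the final block of
      length 1; for \<open>k = 0\<close> one position is left over.\<close>
    have "block_end m k + m + c * (m - 1) \<le> block_end m (Suc m)"
    proof (cases k)
      case 0
      then have "c = m - 1" using len c by (simp add: k_def)
      with 0 m show ?thesis by (simp add: block_end_def)
    next
      case (Suc j)
      have "m - 1 = Suc (j + c)"
        using len c Suc by (simp add: k_def)
      then show ?thesis
        using Suc k by (simp add: block_end_def algebra_simps)
    qed
    then show ?thesis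
      using dist sub m c by (intro subseq_cyc) auto
  qed simp
  have split: "[0..<Suc m] = [0..<k] @ [k..<Suc m]"
    using k by (intro upt_split) simp_all
  have "subseq a (concat (map ?blk [0..<k]))"
    using a subseq_concat_blocks[OF mono_block_end, of 0 k "cyc m" m "Suc m"]
    by (auto intro: subseq_order.trans)
  \<comment> \<open>\<open>Suc m\<close> heads the block with index \<open>k\<close>;
    \<open>b\<close> is found in the rest of that block and the later ones.\<close>
  moreover have "subseq (Suc m # b) (concat (map ?blk [k..<Suc m]))"
  proof -
    have "block_end m k \<le> block_end m (Suc k)" "block_end m (Suc k) \<le> block_end m (Suc m)"
      using k by (auto intro: monoD[OF mono_block_end])
    then have "[block_end m k..<block_end m (Suc m)] =
        [block_end m k..<block_end m (Suc k)] @ [block_end m (Suc k)..<block_end m (Suc m)]"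
      by (rule upt_split)
    moreover have "subseq (map (cyc m) [block_end m (Suc k)..<block_end m (Suc m)])
        (concat (map ?blk [Suc k..<Suc m]))"
      using k by (intro subseq_concat_blocks mono_block_end) simp
    ultimately have "subseq (map (cyc m) [block_end m k..<block_end m (Suc m)])
        (map (cyc m) [block_end m k..<block_end m (Suc k)] @ concat (map ?blk [Suc k..<Suc m]))"
      by (simp add: list_emb_append_mono)
    with b have "subseq b
        (map (cyc m) [block_end m k..<block_end m (Suc k)] @ concat (map ?blk [Suc k..<Suc m]))"
      by (rule subseq_order.trans)
    then show ?thesis
      using k by (simp add: upt_conv_Cons del: upt_Suc)
  qed
  ultimately show "subseq p (short_complete m)"
    unfolding ab short_complete_def split map_append concat_append
    by (rule list_emb_append_mono)
qed

text \<open>There are \<open>m + 1\<close> inserted letters and \<open>m + (m - 1)^2 + 1\<close>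
  cyclic ones; for \<open>n = m + 1\<close> the total is \<open>n^2 - 2n + 4\<close>.\<close>

lemma length_short_complete:
  assumes "m \<ge> 1"
  shows "length (short_complete m) = m\<^sup>2 + 3"
proof -
  obtain j where "m = Suc j"
    using assms by (cases m) auto
  then show ?thesis
    unfolding short_complete_def length_concat_blocks[OF mono_block_end]
    by (simp add: block_end_def power2_eq_square)
qed

lemma ex_complete_word:
  assumes "n \<ge> 1"
  shows "\<exists>w. complete_word n w \<and> real (length w) \<le> (real n)\<^sup>2 - 2 * real n + 4"
proof (cases "n = 1")
  case True
  have "complete_word 1 [1]"
    by (simp add: complete_word_def)
  with True show ?thesis by (intro exI[of _ "[1]"]) simp
next
  case False
  then obtain m where m: "n = Suc m" "m \<ge> 1"
    using assms by (cases n) auto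
  then have "real (length (short_complete m)) = (real n)\<^sup>2 - 2 * real n + 4"
    by (simp add: length_short_complete power2_eq_square algebra_simps)
  with m show ?thesis
    by (intro exI[of _ "short_complete m"]) (simp add: complete_short_complete)
qed

section \<open>Shortest complete words and the cubic bound\<close>

lemma ex_shortest_complete_word:
  assumes "n \<ge> 1"
  shows "\<exists>w. shortest_complete_word n w"
  unfolding shortest_complete_word_def lambda_complete_def
  by (rule LeastI_ex) (use ex_complete_word[OF assms] in blast)

lemma lambda_complete_le:
  assumes "n \<ge> 1"
  shows "real (lambda_complete n) \<le> (real n)\<^sup>2 - 2 * real n + 4"
proof -
  obtain w where w: "complete_word n w" "real (length w) \<le> (real n)\<^sup>2 - 2 * real n + 4"
    using ex_complete_word[OF assms] by blast
  then have "lambda_complete n \<le> length w"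
    unfolding lambda_complete_def by (intro Least_le) blast
  with w show ?thesis by linarith
qed

text \<open>The right-hand side is the exact value of \<open>n\<close> plus the sum of
  \<open>i^2 - 2i + 4\<close> over \<open>1 \<le> i < n\<close>.\<close>

lemma sum_lambda_complete_le:
  "n \<ge> 1 \<Longrightarrow> real (n + (\<Sum>i = 1..n - 1. lambda_complete i))
     \<le> real n ^ 3 / 3 - 3 * real n ^ 2 / 2 + 37 * real n / 6 - 4"
proof (induction n rule: nat_induct_at_least)
  case (Suc n)
  have "(\<Sum>i = 1..Suc n - 1. lambda_complete i)
      = (\<Sum>i = 1..n - 1. lambda_complete i) + lambda_complete n"
    using Suc.hyps by (cases n) simp_all
  then show ?case
    using Suc.IH lambda_complete_le[OF Suc.hyps]
    by (simp add: power2_eq_square power3_eq_cube field_simps)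
qed simp

theorem theorem11:
  shows "(\<forall>\<omega> :: nat \<Rightarrow> nat list. (\<forall>k\<ge>1. shortest_complete_word k (\<omega> k)) \<longrightarrow>
            (\<forall>n\<ge>1. fixes_all_monotone n (W \<omega> n)))
       \<and> (\<forall>n::nat. n \<ge> 1 \<longrightarrow>
            lambda_M n \<le> n + (\<Sum>i = 1..n - 1. lambda_complete i)
          \<and> real (n + (\<Sum>i = 1..n - 1. lambda_complete i))
              \<le> real n ^ 3 / 3 - 3 * real n ^ 2 / 2 + 37 * real n / 6)"
proof -
  have fixes_all: "fixes_all_monotone n (W \<omega> n)"
    if "\<forall>k\<ge>1. shortest_complete_word k (\<omega> k)" "n \<ge> 1" for \<omega> n
    using that by (intro W_fixes_all_monotone) (auto simp: shortest_complete_word_def)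
  have "lambda_M n \<le> n + (\<Sum>i = 1..n - 1. lambda_complete i)" if n: "n \<ge> 1" for n
  proof -
    \<comment> \<open>Shortest complete words exist for all \<open>k \<ge> 1\<close>, so choice
      provides a sequence to instantiate \<open>W\<close>.\<close>
    obtain \<omega> where \<omega>: "\<forall>k\<ge>1. shortest_complete_word k (\<omega> k)"
      using ex_shortest_complete_word by metis
    have "lambda_M n \<le> length (W \<omega> n)"
      unfolding lambda_M_def using fixes_all[OF \<omega> n] by (intro Least_le) blast
    also have "\<dots> = n + (\<Sum>i = 1..n - 1. lambda_complete i)"
      using \<omega> by (simp add: length_W[OF n] shortest_complete_word_def)
    finally show ?thesis .
  qed
  moreover have "real (n + (\<Sum>i = 1..n - 1. lambda_complete i))
      \<le> real n ^ 3 / 3 - 3 * real n ^ 2 / 2 + 37 * real n / 6" if "n \<ge> 1" for n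
    using sum_lambda_complete_le[OF that] by linarith
  ultimately show ?thesis
    using fixes_all by blast
qed

end
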